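(* Let $a,b>0$ be constants and let $D_4$ be a diagonal-norm fourth-derivative SBP operator with associated $H,N\in\mathbb{R}^{m\times m}$ and boundary vectors $e_l,e_r,d_{1;l},d_{1;r},d_{2;l},d_{2;r},d_{3;l},d_{3;r}\in\mathbb{R}^m$. Let $$L_f=\begin{bmatrix} d_{2;l}^\top\\ d_{3;l}^\top\\ d_{2;r}^\top\\ d_{3;r}^\top\end{bmatrix},\qquad P=I_m-H^{-1}L_f^\top(L_fH^{-1}L_f^\top)^{-1}L_f .$$ Then the semi-discrete system $$b\,v_{tt}=-a\,P D_4 P\,v$$ is a stable approximation of the dynamic beam equation $b u_{tt}=-a u_{xxxx}$, $x\in[x_l,x_r]$, with free boundary conditions $u_{xx}=0$, $u_{xxx}=0$ at $x=x_l$ and $x=x_r$.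
   Context: The interval $[x_l,x_r]$ is discretized by $m$ equidistant points with spacing $h=(x_r-x_l)/(m-1)$; $v(t)\in\mathbb{R}^m$ is the vector of grid values approximating $u(\cdot,t)$. $I_m$ is the $m\times m$ identity matrix. $e_l=(1,0,\dots,0)^\top$, $e_r=(0,\dots,0,1)^\top$. Diagonal-norm fourth-derivative SBP operator: a matrix $$D_4=H^{-1}\left(N+e_l d_{3;l}^\top+d_{1;l}d_{2;l}^\top+e_r d_{3;r}^\top-d_{1;r}d_{2;r}^\top\right)$$ approximating $\partial^4/\partial x^4$ (with a $2p$th-order accurate narrow stencil in the interior), where $H=H^\top>0$ is diagonal, $N=N^\top\ge 0$ (positive semi-definite), and $d_{1;l}^\top v\approx -u_x|_{x_l}$, $d_{1;r}^\top v\approx u_x|_{x_r}$, $d_{2;l}^\top v\approx -u_{xx}|_{x_l}$, $d_{2;r}^\top v\approx u_{xx}|_{x_r}$, $d_{3;l}^\top v\approx -u_{xxx}|_{x_l}$, $d_{3;r}^\top v\approx u_{xxx}|_{x_r}$ are finite difference approximations of the boundary derivatives. The free conditions are discretized as $L_f v=0$. The rows of $L_f$ are assumed linearly independent, so that the inverse in $P$ exists. Write $\|v\|_H^2=v^\top Hv$. Stable (in the energy sense, with zero boundary and forcing data) means: there is a time-independent symmetric positive semi-definite matrix $M\in\mathbb{R}^{m\times m}$ such that for every twice continuously differentiable solution $v(t)$ of the system, the energy $E=b\|v_t\|_H^2+v^\top M v$ satisfies $\frac{d}{dt}E\le 0$. *)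

theory Defs
  imports "HOL-Analysis.Analysis" "HOL-Computational_Algebra.Polynomial"
begin

(* Grid vectors have type real^'m with 'm a finite linear order: m is CARD('m), and the order on
   'm is the left-to-right order of the grid points. *)

definition grid_pos :: "'m::{finite,linorder} \<Rightarrow> nat" where
  "grid_pos i = card {..<i}"

definition grid_point :: "real \<Rightarrow> real \<Rightarrow> 'm::{finite,linorder} \<Rightarrow> real" where
  "grid_point xl xr i = xl + real (grid_pos i) * ((xr - xl) / (real CARD('m) - 1))"

definition grid_fun :: "real \<Rightarrow> real \<Rightarrow> (real \<Rightarrow> real) \<Rightarrow> real^'m::{finite,linorder}" where
  "grid_fun xl xr u = (\<chi> i. u (grid_point xl xr i))"

definition e_left :: "real^'m::{finite,linorder}" where
  "e_left = axis (Min UNIV) 1"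

definition e_right :: "real^'m::{finite,linorder}" where
  "e_right = axis (Max UNIV) 1"

definition outer_product :: "real^'m \<Rightarrow> real^'m \<Rightarrow> real^'m^'m" where
  "outer_product x y = (columnvector x :: real^1^'m) ** (rowvector y :: real^'m^1)"

definition sym_pos_semidef :: "real^'m^'m \<Rightarrow> bool" where
  "sym_pos_semidef A \<longleftrightarrow> transpose A = A \<and> (\<forall>x. 0 \<le> x \<bullet> (A *v x))"

definition sym_pos_def :: "real^'m^'m \<Rightarrow> bool" where
  "sym_pos_def A \<longleftrightarrow> transpose A = A \<and> (\<forall>x. x \<noteq> 0 \<longrightarrow> 0 < x \<bullet> (A *v x))"

definition diagonal_matrix :: "real^'m^'m \<Rightarrow> bool" where
  "diagonal_matrix A \<longleftrightarrow> (\<forall>i j. i \<noteq> j \<longrightarrow> A $ i $ j = 0)"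

(* The functional d^T approximates sg * (d/dx)^k at the point x0. Consistency of a
   difference formula for the k-th derivative is exactness on polynomials of degree at most k. *)
definition approximates_deriv_at ::
    "real \<Rightarrow> real \<Rightarrow> real^'m::{finite,linorder} \<Rightarrow> real \<Rightarrow> nat \<Rightarrow> real \<Rightarrow> bool" where
  "approximates_deriv_at xl xr d sg k x0 \<longleftrightarrow>
     (\<forall>q :: real poly. degree q \<le> k \<longrightarrow>
        d \<bullet> grid_fun xl xr (poly q) = sg * poly ((pderiv ^^ k) q) x0)"

(* Away from s closure rows at either boundary, D is the narrow stencil (half-width p + 1,
   i.e. 2p + 3 points) of order 2p for the fourth derivative. Order 2p means exactness up to
   degree 2p + 3; width and exactness together determine the stencil uniquely. *)
definition narrow_interior_D4 :: "nat \<Rightarrow> real \<Rightarrow> real \<Rightarrow> real^'m::{finite,linorder}^'m::{finite,linorder} \<Rightarrow> bool" where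
  "narrow_interior_D4 p xl xr D \<longleftrightarrow>
     (\<exists>s. 2 * s < CARD('m) \<and>
        (\<forall>i. s \<le> grid_pos i \<and> grid_pos i + s < CARD('m) \<longrightarrow>
           (\<forall>j. D $ i $ j \<noteq> 0 \<longrightarrow> \<bar>int (grid_pos i) - int (grid_pos j)\<bar> \<le> int p + 1) \<and>
           (\<forall>q :: real poly. degree q \<le> 2 * p + 3 \<longrightarrow>
              (D *v grid_fun xl xr (poly q)) $ i = poly ((pderiv ^^ 4) q) (grid_point xl xr i))))"

(* Signs: d1l, d2l, d3l approximate minus the derivative at xl; d1r, d2r, d3r approximate plus
   the derivative at xr. *)
definition diagonal_norm_D4_SBP ::
    "nat \<Rightarrow> real \<Rightarrow> real \<Rightarrow> real^'m::{finite,linorder}^'m::{finite,linorder} \<Rightarrow> real^'m::{finite,linorder}^'m::{finite,linorder} \<Rightarrow> real^'m::{finite,linorder}^'m::{finite,linorder} \<Rightarrow>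
     real^'m::{finite,linorder} \<Rightarrow> real^'m::{finite,linorder} \<Rightarrow> real^'m::{finite,linorder} \<Rightarrow>
     real^'m::{finite,linorder} \<Rightarrow> real^'m::{finite,linorder} \<Rightarrow> real^'m::{finite,linorder} \<Rightarrow> bool" where
  "diagonal_norm_D4_SBP p xl xr D4 H N d1l d2l d3l d1r d2r d3r \<longleftrightarrow>
     diagonal_matrix H \<and> sym_pos_def H \<and> sym_pos_semidef N \<and>
     D4 = matrix_inv H ** (N + outer_product e_left d3l + outer_product d1l d2l
                             + outer_product e_right d3r - outer_product d1r d2r) \<and>
     narrow_interior_D4 p xl xr D4 \<and>
     approximates_deriv_at xl xr d1l (- 1) 1 xl \<and> approximates_deriv_at xl xr d1r 1 1 xr \<and>
     approximates_deriv_at xl xr d2l (- 1) 2 xl \<and> approximates_deriv_at xl xr d2r 1 2 xr \<and>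
     approximates_deriv_at xl xr d3l (- 1) 3 xl \<and> approximates_deriv_at xl xr d3r 1 3 xr"

definition free_bc_operator ::
    "real^'m \<Rightarrow> real^'m \<Rightarrow> real^'m \<Rightarrow> real^'m \<Rightarrow> real^'m^4" where
  "free_bc_operator d2l d3l d2r d3r = vector [d2l, d3l, d2r, d3r]"

(* Injectivity is needed because rows L is a set and forgets repeated rows. *)
definition lin_indep_rows :: "real^'m^'k \<Rightarrow> bool" where
  "lin_indep_rows L \<longleftrightarrow> inj (\<lambda>i. row i L) \<and> independent (rows L)"

definition bc_projection :: "real^'m^'m \<Rightarrow> real^'m^'k \<Rightarrow> real^'m^'m" where
  "bc_projection H L =
     mat 1 - matrix_inv H ** transpose L ** matrix_inv (L ** matrix_inv H ** transpose L) ** L"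

(* v is a C^2 solution of b v_tt = F v on t >= 0, with v' = v_t and v'' = v_tt *)
definition semidiscrete_solution ::
    "real \<Rightarrow> real^'m^'m \<Rightarrow> (real \<Rightarrow> real^'m) \<Rightarrow> (real \<Rightarrow> real^'m) \<Rightarrow> (real \<Rightarrow> real^'m) \<Rightarrow> bool" where
  "semidiscrete_solution b F v v' v'' \<longleftrightarrow>
     (\<forall>t\<ge>0. (v has_vector_derivative v' t) (at t within {0..})) \<and>
     (\<forall>t\<ge>0. (v' has_vector_derivative v'' t) (at t within {0..})) \<and>
     continuous_on {0..} v'' \<and>
     (\<forall>t\<ge>0. b *\<^sub>R v'' t = F *v v t)"

definition beam_energy ::
    "real \<Rightarrow> real^'m^'m \<Rightarrow> real^'m^'m \<Rightarrow> (real \<Rightarrow> real^'m) \<Rightarrow> (real \<Rightarrow> real^'m) \<Rightarrow> real \<Rightarrow> real" where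
  "beam_energy b H M v v' t = b * (v' t \<bullet> (H *v v' t)) + v t \<bullet> (M *v v t)"

definition energy_stable :: "real \<Rightarrow> real^'m^'m \<Rightarrow> real^'m^'m \<Rightarrow> bool" where
  "energy_stable b H F \<longleftrightarrow>
     (\<exists>M. sym_pos_semidef M \<and>
        (\<forall>v v' v''. semidiscrete_solution b F v v' v'' \<longrightarrow>
           (\<forall>t\<ge>0. \<exists>E'. (beam_energy b H M v v' has_real_derivative E') (at t within {0..}) \<and> E' \<le> 0)))"

end

theory Submission
  imports Defs
begin

text \<open>
  \<open>P\<close> is the \<open>H\<close>-orthogonal projection onto the kernel of \<open>L\<^sub>f\<close>: it is self-adjoint for the inner
  product of \<open>H\<close> and \<open>L\<^sub>f P = 0\<close>. Hence \<open>H P D\<^sub>4 P = P\<^sup>T (H D\<^sub>4) P\<close>, in which every boundary term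
  contains one of \<open>d\<^sub>2\<^sup>T P\<close>, \<open>d\<^sub>3\<^sup>T P\<close> and vanishes, leaving \<open>P\<^sup>T N P\<close>. With \<open>M = a P\<^sup>T N P\<close> the energy
  is therefore conserved.
\<close>

lemma transpose_minus: "transpose (A - B) = transpose A - transpose (B :: real^'n^'m)"
  by (simp add: vec_eq_iff transpose_def)

lemma matrix_mul_diff_right: "A ** (B - C) = A ** B - A ** (C :: real^'k^'n)"
  by (simp add: vec_eq_iff matrix_matrix_mult_def right_diff_distrib sum_subtractf)

lemma matrix_mul_diff_left: "(A - B) ** C = A ** C - B ** (C :: real^'k^'n)"
  by (simp add: vec_eq_iff matrix_matrix_mult_def left_diff_distrib sum_subtractf)

lemma outer_product_mult_vector: "outer_product x y *v z = (y \<bullet> z) *\<^sub>R x"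
  by (simp add: vec_eq_iff outer_product_def matrix_vector_mult_def matrix_matrix_mult_def
      columnvector_def rowvector_def inner_vec_def sum_distrib_left sum_distrib_right mult_ac)

text \<open>\<open>matrix_inv\<close> is a Hilbert choice of a two-sided inverse; invertibility
  supplies the witness that makes the choice satisfy its defining equations.\<close>

lemma
  fixes A :: "real^'n^'n"
  assumes "invertible A"
  shows matrix_inv_right: "A ** matrix_inv A = mat 1"
    and matrix_inv_left: "matrix_inv A ** A = mat 1"
  using assms someI_ex[of "\<lambda>B. A ** B = mat 1 \<and> B ** A = mat 1"]
  unfolding invertible_def matrix_inv_def by auto

lemma matrix_inv_symmetric:
  fixes A :: "real^'n^'n"
  assumes "invertible A" "transpose A = A"
  shows "transpose (matrix_inv A) = matrix_inv A"
  by (metis assms matrix_inv_left matrix_inv_right matrix_mul_assoc matrix_mul_lid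
      matrix_mul_rid matrix_transpose_mul transpose_mat)

text \<open>A vector in the kernel makes the quadratic form zero, so by definiteness it vanishes; a
  square matrix with trivial kernel is invertible.\<close>

lemma sym_pos_def_invertible:
  assumes "sym_pos_def A"
  shows "invertible A"
  unfolding invertible_left_inverse matrix_left_invertible_ker
  using assms by (metis inner_zero_right less_irrefl sym_pos_def_def)

text \<open>Substituting \<open>x = A *v y\<close> turns the form of the inverse at \<open>x\<close>
  into the form of \<open>A\<close> at \<open>y\<close>.\<close>

lemma sym_pos_def_matrix_inv:
  assumes "sym_pos_def A"
  shows "sym_pos_def (matrix_inv A)"
proof -
  have inv: "invertible A" and sym: "transpose A = A"
    using assms by (auto simp: sym_pos_def_invertible sym_pos_def_def)
  have "0 < x \<bullet> (matrix_inv A *v x)" if "x \<noteq> 0" for x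
  proof -
    have x: "A *v (matrix_inv A *v x) = x"
      by (simp add: matrix_vector_mul_assoc matrix_inv_right inv)
    then have "matrix_inv A *v x \<noteq> 0"
      using that by force
    then show ?thesis
      using assms x by (metis inner_commute sym_pos_def_def)
  qed
  then show ?thesis
    by (simp add: sym_pos_def_def matrix_inv_symmetric inv sym)
qed

text \<open>\<open>transpose L *v x\<close> is the linear combination of the rows of
  \<open>L\<close> with coefficients \<open>x $ i\<close>.\<close>

lemma lin_indep_rows_ker_transpose:
  fixes L :: "real^'m^'k"
  assumes "lin_indep_rows L" "transpose L *v x = 0"
  shows "x = 0"
proof -
  have inj: "inj (\<lambda>i. row i L)" and ind: "independent (rows L)"
    using assms by (auto simp: lin_indep_rows_def)
  have rows: "rows L = range (\<lambda>i. row i L)"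
    by (auto simp: rows_def)
  \<comment> \<open>Independence speaks of the set \<open>rows L\<close>, so the coefficients have
    to be indexed by rows; distinct indices give distinct rows, so none is lost.\<close>
  define u where "u r = x $ (inv (\<lambda>i. row i L) r)" for r
  have "(\<Sum>r\<in>rows L. u r *\<^sub>R r) = (\<Sum>i\<in>UNIV. x $ i *\<^sub>R row i L)"
    unfolding rows by (subst sum.reindex[OF inj]) (simp add: u_def inv_f_f[OF inj])
  also have "\<dots> = transpose L *v x"
    by (simp add: vec_eq_iff row_def transpose_def matrix_vector_mult_def mult.commute)
  finally have "(\<Sum>r\<in>rows L. u r *\<^sub>R r) = 0"
    using assms by simp
  moreover have "finite (rows L)"
    by (simp add: rows)
  ultimately have "\<forall>r\<in>rows L. u r = 0"
    using ind independent_explicit by blast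
  then have "x $ i = 0" for i
    by (simp add: rows u_def inv_f_f[OF inj])
  then show ?thesis
    by (simp add: vec_eq_iff)
qed

text \<open>The form at \<open>x\<close> is that of \<open>G\<close> at
  \<open>transpose L *v x\<close>, which is nonzero by the kernel lemma. With
  \<open>G = matrix_inv H\<close> this makes the inner inverse in \<open>bc_projection\<close> a
  genuine one.\<close>

lemma sym_pos_def_congruence:
  fixes L :: "real^'m^'k"
  assumes G: "sym_pos_def G" and L: "lin_indep_rows L"
  shows "sym_pos_def (L ** G ** transpose L)"
proof -
  have "0 < x \<bullet> ((L ** G ** transpose L) *v x)" if "x \<noteq> 0" for x
  proof -
    have "transpose L *v x \<noteq> 0"
      using lin_indep_rows_ker_transpose[OF L] that by blast
    then have "0 < (transpose L *v x) \<bullet> (G *v (transpose L *v x))"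
      using G by (simp add: sym_pos_def_def)
    then show ?thesis
      by (simp add: dot_lmul_matrix transpose_matrix_vector flip: matrix_vector_mul_assoc)
  qed
  moreover have "transpose (L ** G ** transpose L) = L ** G ** transpose L"
    using G by (simp add: sym_pos_def_def matrix_transpose_mul matrix_mul_assoc)
  ultimately show ?thesis
    by (simp add: sym_pos_def_def)
qed

text \<open>Shows that the energy matrix, with \<open>c = a\<close>, is admissible: its form at
  \<open>x\<close> is \<open>c\<close> times that of \<open>N\<close> at
  \<open>P *v x\<close>.\<close>

lemma sym_pos_semidef_congruence:
  fixes N P :: "real^'m^'m"
  assumes "sym_pos_semidef N" "0 \<le> c"
  shows "sym_pos_semidef (c *\<^sub>R (transpose P ** N ** P))"
proof -
  have "x \<bullet> ((transpose P ** N ** P) *v x) = (P *v x) \<bullet> (N *v (P *v x))" for x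
    by (metis dot_lmul_matrix transpose_matrix_vector transpose_transpose matrix_vector_mul_assoc)
  then show ?thesis
    using assms
    by (simp add: sym_pos_semidef_def transpose_scalar matrix_transpose_mul matrix_mul_assoc
        flip: scaleR_matrix_vector_assoc)
qed

text \<open>Multiplying out gives \<open>L - ?K ** matrix_inv ?K ** L\<close>, and the two terms
  cancel.\<close>

lemma bc_projection_annihilates:
  fixes L :: "real^'m^'k"
  assumes "sym_pos_def H" "lin_indep_rows L"
  shows "L ** bc_projection H L = 0"
proof -
  let ?K = "L ** matrix_inv H ** transpose L"
  have "invertible ?K"
    by (intro sym_pos_def_invertible sym_pos_def_congruence sym_pos_def_matrix_inv assms)
  then have "?K ** matrix_inv ?K = mat 1"
    by (rule matrix_inv_right)
  then show ?thesis
    by (simp add: bc_projection_def matrix_mul_diff_right matrix_mul_assoc)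
qed

text \<open>Both sides reduce to \<open>H - transpose L ** matrix_inv ?K ** L\<close>, since
  \<open>?K\<close> and \<open>H\<close> have symmetric inverses.\<close>

lemma bc_projection_self_adjoint:
  fixes L :: "real^'m^'k"
  assumes H: "sym_pos_def H" and L: "lin_indep_rows L"
  shows "H ** bc_projection H L = transpose (bc_projection H L) ** H"
proof -
  let ?G = "matrix_inv H"
  let ?K = "L ** ?G ** transpose L"
  have G: "sym_pos_def ?G" and K: "sym_pos_def ?K"
    by (intro sym_pos_def_congruence sym_pos_def_matrix_inv H L)+
  have sG: "transpose ?G = ?G" and sK: "transpose (matrix_inv ?K) = matrix_inv ?K"
    using G sym_pos_def_matrix_inv[OF K] by (auto simp: sym_pos_def_def)
  have HG: "H ** ?G = mat 1" and GH: "?G ** H = mat 1"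
    using sym_pos_def_invertible[OF H] by (auto simp: matrix_inv_right matrix_inv_left)
  have "H ** bc_projection H L = H - transpose L ** matrix_inv ?K ** L"
    by (simp add: bc_projection_def matrix_mul_diff_right matrix_mul_assoc HG)
  moreover have "transpose (bc_projection H L) ** H
      = H - transpose L ** matrix_inv ?K ** L ** (?G ** H)"
    by (simp add: bc_projection_def matrix_mul_diff_left transpose_minus matrix_transpose_mul
        sG sK[unfolded matrix_mul_assoc[symmetric]] flip: matrix_mul_assoc)
  ultimately show ?thesis
    by (simp add: GH)
qed

text \<open>With \<open>S\<close> as the matrix in the energy, the derivative is twice the inner
  product of \<open>v' t\<close> with \<open>b *\<^sub>R (H *v v'' t) + S *v v t\<close>, which is
  zero by the equation of motion.\<close>

lemma energy_stable_if_symmetric: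
  fixes F H :: "real^'m^'m"
  assumes H: "transpose H = H" and S: "sym_pos_semidef S" and HF: "\<And>x. H *v (F *v x) = - (S *v x)"
  shows "energy_stable b H F"
  unfolding energy_stable_def
proof (intro exI[of _ S] conjI allI impI S)
  fix v v' v'' :: "real \<Rightarrow> real^'m" and t :: real
  assume sol: "semidiscrete_solution b F v v' v''" and t: "0 \<le> t"
  let ?T = "at t within {0..}"
  have sym: "x \<bullet> (A *v y) = y \<bullet> (A *v x)" if "transpose A = A" for A :: "real^'m^'m" and x y
    using that by (metis dot_lmul_matrix inner_commute transpose_matrix_vector)
  have d: "(v has_vector_derivative v' t) ?T" "(v' has_vector_derivative v'' t) ?T"
    and eq: "b *\<^sub>R v'' t = F *v v t"
    using sol t by (auto simp: semidiscrete_solution_def)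
  \<comment> \<open>The product rule yields two terms that coincide because \<open>A\<close> is
    symmetric; used below for \<open>v'\<close> with \<open>H\<close> and for \<open>v\<close> with
    \<open>S\<close>.\<close>
  have quad: "((\<lambda>s. w s \<bullet> (A *v w s)) has_real_derivative 2 * (w1 \<bullet> (A *v w t))) ?T"
    if w: "(w has_vector_derivative w1) ?T" and A: "transpose A = A"
    for w w1 and A :: "real^'m^'m"
  proof -
    have "((\<lambda>s. A *v w s) has_vector_derivative A *v w1) ?T"
      by (rule bounded_linear.has_vector_derivative[OF matrix_vector_mul_bounded_linear w])
    from bounded_bilinear.has_vector_derivative[OF bounded_bilinear_inner w this]
    have "((\<lambda>s. w s \<bullet> (A *v w s)) has_real_derivative w t \<bullet> (A *v w1) + w1 \<bullet> (A *v w t)) ?T"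
      by (simp add: has_real_derivative_iff_has_vector_derivative)
    then show ?thesis
      using sym[OF A, of "w t" w1] by simp
  qed
  \<comment> \<open>\<open>b\<close> is moved onto \<open>v'' t\<close> so that the differential
    equation can be substituted.\<close>
  have "b * (v'' t \<bullet> (H *v v' t)) = v' t \<bullet> (H *v (b *\<^sub>R v'' t))"
    by (simp add: sym[OF H, of "v'' t"] matrix_vector_mult_scaleR)
  also have "\<dots> = - (v' t \<bullet> (S *v v t))"
    by (simp add: eq HF)
  finally have zero: "b * (2 * (v'' t \<bullet> (H *v v' t))) + 2 * (v' t \<bullet> (S *v v t)) = 0"
    by simp
  have "(beam_energy b H S v v' has_real_derivative
      b * (2 * (v'' t \<bullet> (H *v v' t))) + 2 * (v' t \<bullet> (S *v v t))) ?T"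
    unfolding beam_energy_def[abs_def]
    using S by (intro DERIV_add DERIV_cmult quad d H) (simp add: sym_pos_semidef_def)
  then show "\<exists>E'. (beam_energy b H S v v' has_real_derivative E') ?T \<and> E' \<le> 0"
    using zero by fastforce
qed

theorem lemma4:
  fixes a b xl xr :: real
    and p :: nat
    and D4 H N :: "real^'m::{finite,linorder}^'m::{finite,linorder}"
    and d1l d2l d3l d1r d2r d3r :: "real^'m::{finite,linorder}"
    and L :: "real^'m::{finite,linorder}^4" and P :: "real^'m::{finite,linorder}^'m::{finite,linorder}"
  assumes "a > 0" and "b > 0" and "xl < xr" and "p \<ge> 1"
    and "diagonal_norm_D4_SBP p xl xr D4 H N d1l d2l d3l d1r d2r d3r"
    and "L = free_bc_operator d2l d3l d2r d3r"
    and "lin_indep_rows L"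
    and "P = bc_projection H L"
  shows "energy_stable b H ((- a) *\<^sub>R (P ** D4 ** P))"
proof -
  define B where "B = N + outer_product e_left d3l + outer_product d1l d2l
                        + outer_product e_right d3r - outer_product d1r d2r"
  have H: "sym_pos_def H" and N: "sym_pos_semidef N" and D4: "D4 = matrix_inv H ** B"
    using assms(5) by (auto simp: diagonal_norm_D4_SBP_def B_def)
  have HD4: "H ** D4 = B"
    by (simp add: D4 matrix_mul_assoc matrix_inv_right sym_pos_def_invertible[OF H])
  have "L *v (P *v x) = 0" for x
    using bc_projection_annihilates[OF H assms(7)] assms(8)
    by (simp add: matrix_vector_mul_assoc)
  moreover have "(L *v y) $ i = L $ i \<bullet> y" for y i
    by (simp add: matrix_vector_mul_component)
  ultimately have LP: "L $ i \<bullet> (P *v x) = 0" for i x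
    by (metis zero_index)
  have bc: "d2l \<bullet> (P *v x) = 0" "d3l \<bullet> (P *v x) = 0" "d2r \<bullet> (P *v x) = 0" "d3r \<bullet> (P *v x) = 0" for x
    using LP[of 1 x] LP[of 2 x] LP[of 3 x] LP[of 4 x]
    by (simp_all add: assms(6) free_bc_operator_def vector_def)
  \<comment> \<open>The second factor of every outer product in \<open>B\<close> is one of the four
    rows of \<open>L\<close>, so its product with \<open>P *v x\<close> is zero.\<close>
  have BP: "B *v (P *v x) = N *v (P *v x)" for x
    by (simp add: B_def matrix_vector_mult_add_rdistrib matrix_vector_mult_diff_rdistrib
        outer_product_mult_vector bc)
  have HP: "H ** P = transpose P ** H"
    using bc_projection_self_adjoint[OF H assms(7)] assms(8) by simp
  \<comment> \<open>Self-adjointness carries \<open>H\<close> past the left \<open>P\<close>, where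
    it cancels the inverse of \<open>H\<close> in \<open>D4\<close>.\<close>
  have "H ** (P ** D4 ** P) = transpose P ** B ** P"
    by (simp add: matrix_mul_assoc HP flip: HD4)
  then have "H *v ((P ** D4 ** P) *v x) = (transpose P ** N ** P) *v x" for x
    by (simp add: matrix_vector_mul_assoc) (simp only: BP flip: matrix_vector_mul_assoc)
  then have "H *v (((- a) *\<^sub>R (P ** D4 ** P)) *v x) = - ((a *\<^sub>R (transpose P ** N ** P)) *v x)" for x
    by (simp add: matrix_vector_mult_scaleR del: scaleR_minus_left
        flip: scaleR_matrix_vector_assoc) simp
  \<comment> \<open>The energy matrix is \<open>a *\<^sub>R (transpose P ** N ** P)\<close>; its
    semidefiniteness uses \<open>a > 0\<close>.\<close>
  then show ?thesis
    using H N assms(1)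
    by (intro energy_stable_if_symmetric[OF _ sym_pos_semidef_congruence[of N a P]])
      (auto simp: sym_pos_def_def)
qed

end
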